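(* Every $\mathit{LTL}^{\Box\bigcirc}_{\mathit{bool}}$ OMQ $\boldsymbol q=(\mathcal O,\psi(\boldsymbol t))$, where $\psi(\boldsymbol t)$ is an arbitrary $\mathrm{MFO}(<)$-formula, is $\mathrm{FO}(\mathrm{RPR})$-rewritable, and so $\mathrm{MSO}(<)$-rewritable.
   Context: Fix a countably infinite set of atomic concepts. An interpretation $\mathfrak M$ assigns to each atomic concept $A$ a set $A^{\mathfrak M}\subseteq\mathbb Z$. Basic temporal concepts $C::=A_i\mid\Box_F C\mid\Box_P C\mid\bigcirc_F C\mid\bigcirc_P C$ are interpreted by $(\Box_F C)^{\mathfrak M}=\{n\mid k\in C^{\mathfrak M}\ \forall k>n\}$, $(\Box_P C)^{\mathfrak M}=\{n\mid k\in C^{\mathfrak M}\ \forall k<n\}$, $(\bigcirc_F C)^{\mathfrak M}=\{n\mid n+1\in C^{\mathfrak M}\}$, $(\bigcirc_P C)^{\mathfrak M}=\{n\mid n-1\in C^{\mathfrak M}\}$. An $\mathit{LTL}^{\Box\bigcirc}_{\mathit{bool}}$ ontology $\mathcal O$ is a finite set of clauses $C_1\land\dots\land C_k\to C_{k+1}\lor\dots\lor C_{k+m}$, $k,m\ge0$, with basic temporal concepts $C_i$ (empty $\land$ is $\top$, empty $\lor$ is $\bot$); a clause is true in $\mathfrak M$ if $\bigcap_{i\le k}C_i^{\mathfrak M}\subseteq\bigcup_{j=1}^{m}C_{k+j}^{\mathfrak M}$ (empty $\bigcap$ is $\mathbb Z$, empty $\bigcup$ is $\emptyset$). A data instance $\mathcal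 A$ is a finite set of ground atoms $A_i(\ell)$, $\ell\in\mathbb Z$; it is assumed throughout that the least integer $\min\mathcal A$ occurring in it is $0$ and the greatest one satisfies $\max\mathcal A\ge1$; $\mathrm{tem}(\mathcal A)=\{n\in\mathbb Z\mid\min\mathcal A\le n\le\max\mathcal A\}$. $\mathfrak M$ is a model of $(\mathcal O,\mathcal A)$ if all clauses of $\mathcal O$ are true in $\mathfrak M$ and $\ell\in A^{\mathfrak M}$ for all $A(\ell)\in\mathcal A$. $\mathrm{MFO}(<)$-formulas are first-order formulas built from atoms $A(t)$ ($A$ an atomic concept), $(t<t')$ and the abbreviations $(t=t')$, $(t=t'+1)$; they are evaluated in interpretations $\mathfrak M$ as in first-order logic over the domain $(\mathbb Z,<)$. An OMQ is a pair $\boldsymbol q=(\mathcal O,\psi(\boldsymbol t))$, where $\boldsymbol t=(t_1,\dots,t_m)$, $m\ge0$, are the free variables of $\psi$. A tuple $\boldsymbol\ell$ in $\mathrm{tem}(\mathcal A)$ is a certain answer to $\boldsymbol q$ over $\mathcal A$ if $\mathfrak M\models\psi(\boldsymbol\ell)$ for every model $\mathfrak M$ of $(\mathcal O,\mathcal A)$; for $m=0$, $\boldsymbol q$ is entailed over $\mathcal A$ if $\mathfrak M\models\psi$ for every model $\mathfrak M$ of $(\mathcal O,\mathcal A)$. $\mathfrak S_{\mathcal A}$ is the finite first-order structure with domain $\mathrm{tem}(\mathcal A)$ ordered by $<$ in which $A(\ell)$ holds iff $A(\ell)\in\mathcal A$. For a class $\mathcal L$ of formulas, $\boldsymbol q$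 is $\mathcal L$-rewritable if there is an $\mathcal L$-formula $\boldsymbol Q(\boldsymbol t)$ such that, for every data instance $\mathcal A$ and every $m$-tuple $\boldsymbol\ell$ in $\mathrm{tem}(\mathcal A)$, $\boldsymbol\ell$ is a certain answer to $\boldsymbol q$ over $\mathcal A$ iff $\mathfrak S_{\mathcal A}\models\boldsymbol Q(\boldsymbol\ell)$ (for $m=0$: an $\mathcal L$-sentence $\boldsymbol Q$ with $\boldsymbol q$ entailed over $\mathcal A$ iff $\mathfrak S_{\mathcal A}\models\boldsymbol Q$). $\mathrm{MSO}(<)$-formulas are built from atoms $A(t)$ and $t<t'$ using the Booleans, first-order quantifiers, and second-order quantifiers over unary predicates. $\mathrm{FO}(\mathrm{RPR})$ extends first-order logic over the unary predicates and the successor relation with relational primitive recursion: if $\Theta_1,\dots,\Theta_n,\Psi$ are $\mathrm{FO}(\mathrm{RPR})$-formulas, one may form $$\big[\,Q_i(\boldsymbol z_i,t)\equiv\Theta_i(\boldsymbol z_i,t,Q_1(\boldsymbol z_1,t-1),\dots,Q_n(\boldsymbol z_n,t-1)),\ 1\le i\le n\,\big]\ \Psi(\boldsymbol z,\boldsymbol z_1,\dots,\boldsymbol z_n),$$ where the bracketed part defines the relations $Q_i$ used in $\Psi$ by recursion on $t=0,1,2,\dots$ in $\mathrm{tem}(\mathcal A)$, with all $Q_i(\boldsymbol z_i,-1)$ taken to be false; each relation variable $Q_i$ occurs in only one recursive definition. *)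

theory Defs
  imports Main
begin

section \<open>Temporal ontologies and their models\<close>

text \<open>The countably infinite set of atomic concepts is fixed to be the natural numbers.\<close>

type_synonym acon = nat
type_synonym var = nat
type_synonym interp = "acon \<Rightarrow> int set"

datatype tconcept =
    Atomic acon
  | BoxF tconcept
  | BoxP tconcept
  | NextF tconcept
  | NextP tconcept

primrec ext :: "interp \<Rightarrow> tconcept \<Rightarrow> int set" where
  "ext M (Atomic A) = M A"
| "ext M (BoxF C) = {n. \<forall>k>n. k \<in> ext M C}"
| "ext M (BoxP C) = {n. \<forall>k<n. k \<in> ext M C}"
| "ext M (NextF C) = {n. n + 1 \<in> ext M C}"
| "ext M (NextP C) = {n. n - 1 \<in> ext M C}"

text \<open>A clause is the list of its conjuncts on the left of the implication together with the list
  of its disjuncts on the right.\<close>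

type_synonym clause = "tconcept list \<times> tconcept list"

definition clause_true :: "interp \<Rightarrow> clause \<Rightarrow> bool" where
  "clause_true M c \<longleftrightarrow> (\<Inter>C\<in>set (fst c). ext M C) \<subseteq> (\<Union>C\<in>set (snd c). ext M C)"

text \<open>\<open>(A, l)\<close> is the ground atom \<open>A(l)\<close>.\<close>

type_synonym data = "(acon \<times> int) set"

definition data_instance :: "data \<Rightarrow> bool" where
  "data_instance \<A> \<longleftrightarrow> finite \<A> \<and> \<A> \<noteq> {} \<and> Min (snd ` \<A>) = 0 \<and> Max (snd ` \<A>) \<ge> 1"

definition tem :: "data \<Rightarrow> int set" where
  "tem \<A> = {Min (snd ` \<A>) .. Max (snd ` \<A>)}"

definition model_of :: "interp \<Rightarrow> clause set \<Rightarrow> data \<Rightarrow> bool" where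
  "model_of M \<O> \<A> \<longleftrightarrow> (\<forall>c\<in>\<O>. clause_true M c) \<and> (\<forall>(A, l)\<in>\<A>. l \<in> M A)"


section \<open>Ontology-mediated queries\<close>

text \<open>\<open>MSuc t t'\<close> is the formula \<open>t = t' + 1\<close>. The remaining Booleans and the universal
  quantifier are the usual abbreviations, here and in the languages below.\<close>

datatype mfo =
    MPred acon var
  | MLess var var
  | MEq var var
  | MSuc var var
  | MNeg mfo
  | MConj mfo mfo
  | MEx var mfo

primrec mfo_fv :: "mfo \<Rightarrow> var set" where
  "mfo_fv (MPred A t) = {t}"
| "mfo_fv (MLess t t') = {t, t'}"
| "mfo_fv (MEq t t') = {t, t'}"
| "mfo_fv (MSuc t t') = {t, t'}"
| "mfo_fv (MNeg \<phi>) = mfo_fv \<phi>"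
| "mfo_fv (MConj \<phi> \<psi>) = mfo_fv \<phi> \<union> mfo_fv \<psi>"
| "mfo_fv (MEx x \<phi>) = mfo_fv \<phi> - {x}"

primrec mfo_sat :: "interp \<Rightarrow> (var \<Rightarrow> int) \<Rightarrow> mfo \<Rightarrow> bool" where
  "mfo_sat M e (MPred A t) \<longleftrightarrow> e t \<in> M A"
| "mfo_sat M e (MLess t t') \<longleftrightarrow> e t < e t'"
| "mfo_sat M e (MEq t t') \<longleftrightarrow> e t = e t'"
| "mfo_sat M e (MSuc t t') \<longleftrightarrow> e t = e t' + 1"
| "mfo_sat M e (MNeg \<phi>) \<longleftrightarrow> \<not> mfo_sat M e \<phi>"
| "mfo_sat M e (MConj \<phi> \<psi>) \<longleftrightarrow> mfo_sat M e \<phi> \<and> mfo_sat M e \<psi>"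
| "mfo_sat M e (MEx x \<phi>) \<longleftrightarrow> (\<exists>n. mfo_sat M (e(x := n)) \<phi>)"

definition upds :: "(var \<Rightarrow> int) \<Rightarrow> var list \<Rightarrow> int list \<Rightarrow> var \<Rightarrow> int" where
  "upds e xs as = (\<lambda>x. case map_of (zip xs as) x of None \<Rightarrow> e x | Some a \<Rightarrow> a)"

text \<open>Variables outside \<open>ts\<close> get the irrelevant value 0, which lies in \<open>tem \<A>\<close> for every
  data instance \<open>\<A>\<close>.\<close>

definition assign :: "var list \<Rightarrow> int list \<Rightarrow> var \<Rightarrow> int" where
  "assign ts ls = upds (\<lambda>_. 0) ts ls"

text \<open>The third component is the tuple of free variables; it is empty for Boolean queries, and
  then the empty tuple is a certain answer iff the query is entailed.\<close>

type_synonym omq = "clause set \<times> mfo \<times> var list"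

fun is_omq :: "omq \<Rightarrow> bool" where
  "is_omq (\<O>, \<psi>, ts) \<longleftrightarrow> finite \<O> \<and> distinct ts \<and> set ts = mfo_fv \<psi>"

fun answer_vars :: "omq \<Rightarrow> var list" where
  "answer_vars (\<O>, \<psi>, ts) = ts"

fun certain_answer :: "omq \<Rightarrow> data \<Rightarrow> int list \<Rightarrow> bool" where
  "certain_answer (\<O>, \<psi>, ts) \<A> ls \<longleftrightarrow>
     length ls = length ts \<and> set ls \<subseteq> tem \<A> \<and>
     (\<forall>M. model_of M \<O> \<A> \<longrightarrow> mfo_sat M (assign ts ls) \<psi>)"


section \<open>Monadic second-order formulas\<close>

text \<open>\<open>SMem X t\<close> is the atom \<open>X(t)\<close> for a second-order variable \<open>X\<close>; these variables are kept
  apart from the atomic concepts.\<close>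

type_synonym setvar = nat

datatype mso =
    SPred acon var
  | SMem setvar var
  | SLess var var
  | SNeg mso
  | SConj mso mso
  | SEx var mso
  | SExSet setvar mso

primrec mso_fv :: "mso \<Rightarrow> var set" where
  "mso_fv (SPred A t) = {t}"
| "mso_fv (SMem X t) = {t}"
| "mso_fv (SLess t t') = {t, t'}"
| "mso_fv (SNeg \<phi>) = mso_fv \<phi>"
| "mso_fv (SConj \<phi> \<psi>) = mso_fv \<phi> \<union> mso_fv \<psi>"
| "mso_fv (SEx x \<phi>) = mso_fv \<phi> - {x}"
| "mso_fv (SExSet X \<phi>) = mso_fv \<phi>"

primrec mso_setfv :: "mso \<Rightarrow> setvar set" where
  "mso_setfv (SPred A t) = {}"
| "mso_setfv (SMem X t) = {X}"
| "mso_setfv (SLess t t') = {}"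
| "mso_setfv (SNeg \<phi>) = mso_setfv \<phi>"
| "mso_setfv (SConj \<phi> \<psi>) = mso_setfv \<phi> \<union> mso_setfv \<psi>"
| "mso_setfv (SEx x \<phi>) = mso_setfv \<phi>"
| "mso_setfv (SExSet X \<phi>) = mso_setfv \<phi> - {X}"

primrec mso_sat ::
  "int set \<Rightarrow> interp \<Rightarrow> (var \<Rightarrow> int) \<Rightarrow> (setvar \<Rightarrow> int set) \<Rightarrow> mso \<Rightarrow> bool" where
  "mso_sat D I e \<sigma> (SPred A t) \<longleftrightarrow> e t \<in> I A"
| "mso_sat D I e \<sigma> (SMem X t) \<longleftrightarrow> e t \<in> \<sigma> X"
| "mso_sat D I e \<sigma> (SLess t t') \<longleftrightarrow> e t < e t'"
| "mso_sat D I e \<sigma> (SNeg \<phi>) \<longleftrightarrow> \<not> mso_sat D I e \<sigma> \<phi>"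
| "mso_sat D I e \<sigma> (SConj \<phi> \<psi>) \<longleftrightarrow> mso_sat D I e \<sigma> \<phi> \<and> mso_sat D I e \<sigma> \<psi>"
| "mso_sat D I e \<sigma> (SEx x \<phi>) \<longleftrightarrow> (\<exists>n\<in>D. mso_sat D I (e(x := n)) \<sigma> \<phi>)"
| "mso_sat D I e \<sigma> (SExSet X \<phi>) \<longleftrightarrow> (\<exists>S\<subseteq>D. mso_sat D I e (\<sigma>(X := S)) \<phi>)"


section \<open>First-order formulas with relational primitive recursion\<close>

type_synonym relvar = nat

text \<open>\<open>RRel Q xs s\<close> is the atom \<open>Q(xs, s)\<close>, \<open>RPrev Q xs s\<close> is the atom \<open>Q(xs, s - 1)\<close>, and
  \<open>RSuc t t'\<close> is \<open>t = t' + 1\<close>. \<open>RRec [(Q\<^sub>1, z\<^sub>1, \<theta>\<^sub>1), \<dots>, (Q\<^sub>n, z\<^sub>n, \<theta>\<^sub>n)] t \<psi>\<close> is the formula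
  \<open>[Q\<^sub>i(z\<^sub>i, t) \<equiv> \<theta>\<^sub>i, 1 \<le> i \<le> n] \<psi>\<close>.\<close>

datatype rpr =
    RPred acon var
  | RSuc var var
  | REq var var
  | RNeg rpr
  | RConj rpr rpr
  | REx var rpr
  | RRel relvar "var list" var
  | RPrev relvar "var list" var
  | RRec "(relvar \<times> var list \<times> rpr) list" var rpr

text \<open>Since \<open>Q\<^sub>j(z\<^sub>j, t - 1)\<close> may occur in \<open>\<theta>\<^sub>i\<close> even if \<open>z\<^sub>j\<close> is not part of \<open>z\<^sub>i\<close>, all of
  \<open>z\<^sub>1, \<dots>, z\<^sub>n\<close> count as free in a recursive definition; the recursion variable \<open>t\<close> is bound.
  The free variables of the \<open>\<theta>\<^sub>i\<close> are restricted by \<open>wf_rpr\<close> below.\<close>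

primrec rpr_fv :: "rpr \<Rightarrow> var set" where
  "rpr_fv (RPred A t) = {t}"
| "rpr_fv (RSuc t t') = {t, t'}"
| "rpr_fv (REq t t') = {t, t'}"
| "rpr_fv (RNeg \<phi>) = rpr_fv \<phi>"
| "rpr_fv (RConj \<phi> \<psi>) = rpr_fv \<phi> \<union> rpr_fv \<psi>"
| "rpr_fv (REx x \<phi>) = rpr_fv \<phi> - {x}"
| "rpr_fv (RRel Q xs s) = insert s (set xs)"
| "rpr_fv (RPrev Q xs s) = insert s (set xs)"
| "rpr_fv (RRec ds t \<psi>) = rpr_fv \<psi> \<union> (\<Union>(Q, z, \<theta>)\<in>set ds. set z)"

text \<open>The relation variables defined in a formula, with repetitions.\<close>

fun rec_vars :: "rpr \<Rightarrow> relvar list" where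
  "rec_vars (RPred A t) = []"
| "rec_vars (RSuc t t') = []"
| "rec_vars (REq t t') = []"
| "rec_vars (RNeg \<phi>) = rec_vars \<phi>"
| "rec_vars (RConj \<phi> \<psi>) = rec_vars \<phi> @ rec_vars \<psi>"
| "rec_vars (REx x \<phi>) = rec_vars \<phi>"
| "rec_vars (RRel Q xs s) = []"
| "rec_vars (RPrev Q xs s) = []"
| "rec_vars (RRec ds t \<psi>) =
     map fst ds @ concat (map (\<lambda>(Q, z, \<theta>). rec_vars \<theta>) ds) @ rec_vars \<psi>"

text \<open>\<open>G\<close> contains the relation variables (with the length of \<open>xs\<close>) that may be used in atoms
  \<open>Q(xs, s)\<close>, and \<open>P\<close> the atoms \<open>Q(z, t - 1)\<close> that may be used. Inside \<open>\<theta>\<^sub>i\<close> the relations being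
  defined are available only through the atoms \<open>Q\<^sub>j(z\<^sub>j, t - 1)\<close>, with exactly the arguments of
  the recursive definition, none of which may be captured by a quantifier: allowing
  \<open>\<exists>z\<^sub>j. Q\<^sub>j(z\<^sub>j, t - 1)\<close> would lead beyond \<open>MSO(<)\<close>. In \<open>\<psi>\<close> the defined relations can be applied
  to arbitrary arguments.\<close>

fun wf_rpr :: "(relvar \<times> nat) set \<Rightarrow> (relvar \<times> var list \<times> var) set \<Rightarrow> rpr \<Rightarrow> bool" where
  "wf_rpr G P (RPred A t) \<longleftrightarrow> True"
| "wf_rpr G P (RSuc t t') \<longleftrightarrow> True"
| "wf_rpr G P (REq t t') \<longleftrightarrow> True"
| "wf_rpr G P (RNeg \<phi>) \<longleftrightarrow> wf_rpr G P \<phi>"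
| "wf_rpr G P (RConj \<phi> \<psi>) \<longleftrightarrow> wf_rpr G P \<phi> \<and> wf_rpr G P \<psi>"
| "wf_rpr G P (REx x \<phi>) \<longleftrightarrow> wf_rpr G {(Q, z, t). (Q, z, t) \<in> P \<and> x \<notin> insert t (set z)} \<phi>"
| "wf_rpr G P (RRel Q xs s) \<longleftrightarrow> (Q, length xs) \<in> G"
| "wf_rpr G P (RPrev Q xs s) \<longleftrightarrow> (Q, xs, s) \<in> P"
| "wf_rpr G P (RRec ds t \<psi>) \<longleftrightarrow>
     (\<forall>(Q, z, \<theta>)\<in>set ds.
        distinct z \<and> t \<notin> set z \<and>
        rpr_fv \<theta> \<subseteq> insert t (\<Union>(Q', z', \<theta>')\<in>set ds. set z') \<and>
        wf_rpr G ((\<lambda>(Q', z', \<theta>'). (Q', z', t)) ` set ds) \<theta>) \<and>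
     wf_rpr (G \<union> (\<lambda>(Q, z, \<theta>). (Q, length z)) ` set ds) P \<psi>"

definition fo_rpr_formula :: "rpr \<Rightarrow> bool" where
  "fo_rpr_formula \<phi> \<longleftrightarrow> distinct (rec_vars \<phi>) \<and> wf_rpr {} {} \<phi>"

text \<open>Relation variables denote relations between the tuple \<open>as\<close> of values of their parameters and
  a time point \<open>s\<close>.\<close>

type_synonym relenv = "relvar \<Rightarrow> int list \<Rightarrow> int \<Rightarrow> bool"

text \<open>\<open>rec_upto fs t e \<rho> k\<close> interprets the relations defined by
  \<open>fs = [(Q\<^sub>1, z\<^sub>1, F\<^sub>1), \<dots>, (Q\<^sub>n, z\<^sub>n, F\<^sub>n)]\<close>, where \<open>F\<^sub>i\<close> is the semantics of \<open>\<theta>\<^sub>i\<close>, correctly at the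
  time points \<open>0, \<dots>, k - 1\<close> and by falsity everywhere else; in particular at \<open>-1\<close>. All other
  relation variables are interpreted by \<open>\<rho>\<close>.\<close>

primrec rec_upto ::
  "(relvar \<times> var list \<times> ((var \<Rightarrow> int) \<Rightarrow> relenv \<Rightarrow> bool)) list \<Rightarrow> var \<Rightarrow>
   (var \<Rightarrow> int) \<Rightarrow> relenv \<Rightarrow> nat \<Rightarrow> relenv" where
  "rec_upto fs t e \<rho> 0 =
     (\<lambda>Q as s. case map_of fs Q of None \<Rightarrow> \<rho> Q as s | Some _ \<Rightarrow> False)"
| "rec_upto fs t e \<rho> (Suc k) =
     (\<lambda>Q as s. case map_of fs Q of
          None \<Rightarrow> \<rho> Q as s
        | Some (z, F) \<Rightarrow>
            if s = int k then F ((upds e z as)(t := s)) (rec_upto fs t e \<rho> k)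
            else rec_upto fs t e \<rho> k Q as s)"

text \<open>The domain \<open>D\<close> is meant to be an initial segment of the natural numbers, so that the
  interpretation of the \<open>Q\<^sub>i\<close> at \<open>s \<in> D\<close> is reached after \<open>s + 1\<close> steps.\<close>

fun rpr_sat :: "int set \<Rightarrow> interp \<Rightarrow> rpr \<Rightarrow> (var \<Rightarrow> int) \<Rightarrow> relenv \<Rightarrow> bool" where
  "rpr_sat D I (RPred A t) e \<rho> \<longleftrightarrow> e t \<in> I A"
| "rpr_sat D I (RSuc t t') e \<rho> \<longleftrightarrow> e t = e t' + 1"
| "rpr_sat D I (REq t t') e \<rho> \<longleftrightarrow> e t = e t'"
| "rpr_sat D I (RNeg \<phi>) e \<rho> \<longleftrightarrow> \<not> rpr_sat D I \<phi> e \<rho>"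
| "rpr_sat D I (RConj \<phi> \<psi>) e \<rho> \<longleftrightarrow> rpr_sat D I \<phi> e \<rho> \<and> rpr_sat D I \<psi> e \<rho>"
| "rpr_sat D I (REx x \<phi>) e \<rho> \<longleftrightarrow> (\<exists>n\<in>D. rpr_sat D I \<phi> (e(x := n)) \<rho>)"
| "rpr_sat D I (RRel Q xs s) e \<rho> \<longleftrightarrow> \<rho> Q (map e xs) (e s)"
| "rpr_sat D I (RPrev Q xs s) e \<rho> \<longleftrightarrow> \<rho> Q (map e xs) (e s - 1)"
| "rpr_sat D I (RRec ds t \<psi>) e \<rho> \<longleftrightarrow>
     rpr_sat D I \<psi> e
       (\<lambda>Q as s. rec_upto (map (\<lambda>(Q, z, \<theta>). (Q, z, rpr_sat D I \<theta>)) ds) t e \<rho>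
                   (nat (s + 1)) Q as s)"


section \<open>Rewritability\<close>

text \<open>The structure \<open>\<SS>\<^sub>\<A>\<close> has the domain \<open>tem \<A>\<close> and interprets the atomic concepts by
  \<open>data_interp \<A>\<close>.\<close>

definition data_interp :: "data \<Rightarrow> interp" where
  "data_interp \<A> A = {l. (A, l) \<in> \<A>}"

text \<open>\<open>holds \<A> e\<close> is the truth value of a candidate rewriting in \<open>\<SS>\<^sub>\<A>\<close> under the assignment
  \<open>e\<close>.\<close>

definition is_rewriting :: "omq \<Rightarrow> (data \<Rightarrow> (var \<Rightarrow> int) \<Rightarrow> bool) \<Rightarrow> bool" where
  "is_rewriting q holds \<longleftrightarrow>
     (\<forall>\<A> ls. data_instance \<A> \<longrightarrow> length ls = length (answer_vars q) \<longrightarrow> set ls \<subseteq> tem \<A> \<longrightarrow>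
        (certain_answer q \<A> ls \<longleftrightarrow> holds \<A> (assign (answer_vars q) ls)))"

definition fo_rpr_rewritable :: "omq \<Rightarrow> bool" where
  "fo_rpr_rewritable q \<longleftrightarrow>
     (\<exists>\<phi>. fo_rpr_formula \<phi> \<and> rpr_fv \<phi> \<subseteq> set (answer_vars q) \<and>
        is_rewriting q (\<lambda>\<A> e. rpr_sat (tem \<A>) (data_interp \<A>) \<phi> e (\<lambda>_ _ _. False)))"

definition mso_rewritable :: "omq \<Rightarrow> bool" where
  "mso_rewritable q \<longleftrightarrow>
     (\<exists>\<phi>. mso_setfv \<phi> = {} \<and> mso_fv \<phi> \<subseteq> set (answer_vars q) \<and>
        is_rewriting q (\<lambda>\<A> e. mso_sat (tem \<A>) (data_interp \<A>) e (\<lambda>_. {}) \<phi>))"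

end

theory Submission imports Defs begin

text \<open>An interpretation together with an assignment is a bi-infinite word over sets of predicates. Call
  a set of such words recognisable if finite words have only finitely many different sets of
  two-sided contexts with respect to it. Recognisability is preserved by complement, intersection
  and nondeterministic relabelling of letters. Hence every first-order formula defines a
  recognisable set, and so does the existence of a model of the ontology and the data that refutes
  the query. The contexts are then the states of a deterministic automaton that reads the data
  instance marked with the candidate answer, and both logics can describe its run: recursion on
  time computes it, monadic second-order logic guesses it.\<close>

section \<open>Recognisable sets of bi-infinite words\<close>

text \<open>The finite factor is pinned to start at 0, where every data instance starts, so no
  shift-invariance is ever required. The left context is a total function read only at negative
  positions, while \<open>r\<close> is indexed from the end of \<open>w\<close>.\<close>

definition biword :: "(int \<Rightarrow> 'a) \<Rightarrow> 'a list \<Rightarrow> (nat \<Rightarrow> 'a) \<Rightarrow> int \<Rightarrow> 'a" where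
  "biword l w r n =
     (if n < 0 then l n else if nat n < length w then w ! nat n else r (nat n - length w))"

definition contexts :: "(int \<Rightarrow> 'a) set \<Rightarrow> 'a list \<Rightarrow> ((int \<Rightarrow> 'a) \<times> (nat \<Rightarrow> 'a)) set" where
  "contexts S w = {(l, r). biword l w r \<in> S}"

definition recognisable :: "(int \<Rightarrow> 'a) set \<Rightarrow> bool" where
  "recognisable S \<longleftrightarrow> finite (range (contexts S))"

text \<open>Finite index is always shown this way: \<open>f\<close> is an invariant with finitely
  many values from which the contexts of a word can be computed.\<close>

lemma recognisableI:
  assumes "\<And>w. f w \<in> A" "finite A" "\<And>w. contexts S w = h (f w)"
  shows "recognisable S"
proof -
  have "range (contexts S) \<subseteq> h ` A"
    using assms(1,3) by auto
  then show ?thesis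
    unfolding recognisable_def using assms(2) finite_surj by blast
qed

lemma recognisable_Compl: "recognisable S \<Longrightarrow> recognisable (- S)"
  by (rule recognisableI[of "contexts S" "range (contexts S)" _ uminus])
     (auto simp add: recognisable_def contexts_def)

lemma recognisable_Int:
  assumes "recognisable S" "recognisable T"
  shows "recognisable (S \<inter> T)"
  by (rule recognisableI[of "\<lambda>w. (contexts S w, contexts T w)"
        "range (contexts S) \<times> range (contexts T)" _ "\<lambda>(X, Y). X \<inter> Y"])
     (use assms in \<open>auto simp: recognisable_def contexts_def\<close>)

text \<open>A position lies left of the factor, inside it or right of it. \<open>R\<close> sees the
  position as well as the letter, so that nested quantifiers linked by an order constraint can be
  split one after the other.\<close>

lemma ex_biword:
  "(\<exists>n. R n (biword l w r n)) \<longleftrightarrow>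
     (\<exists>n<0. R n (l n)) \<or> (\<exists>i<length w. R (int i) (w ! i)) \<or> (\<exists>j. R (int (length w + j)) (r j))"
  (is "?L \<longleftrightarrow> ?R")
proof
  assume ?L
  then obtain n where n: "R n (biword l w r n)" ..
  consider "n < 0" | i where "n = int i" "i < length w" | j where "n = int (length w + j)"
  proof (cases "n < 0")
    case False
    then obtain i where "n = int i" using nonneg_int_cases by (metis not_less)
    then show ?thesis
      using that(2)[of i] that(3)[of "i - length w"] by (cases "i < length w") auto
  qed
  then show ?R
  proof cases
    case 1
    with n have "R n (l n)" by (simp add: biword_def)
    with 1 show ?thesis by blast
  next
    case (2 i)
    with n have "R (int i) (w ! i)" by (simp add: biword_def)
    with 2 show ?thesis by blast
  next
    case (3 j)
    with n have "R (int (length w + j)) (r j)" by (simp add: biword_def del: of_nat_add)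
    then show ?thesis by blast
  qed
next
  assume ?R
  then consider n where "n < 0" "R n (l n)" | i where "i < length w" "R (int i) (w ! i)"
    | j where "R (int (length w + j)) (r j)" by blast
  then show ?L
  proof cases
    case 1
    then have "R n (biword l w r n)" by (simp add: biword_def)
    then show ?thesis ..
  next
    case (2 i)
    then have "R (int i) (biword l w r (int i))" by (simp add: biword_def)
    then show ?thesis ..
  next
    case (3 j)
    then have "R (int (length w + j)) (biword l w r (int (length w + j)))"
      by (simp add: biword_def del: of_nat_add)
    then show ?thesis ..
  qed
qed

text \<open>The invariant is a single bit: whether the factor contains a
  \<open>P\<close>-letter.\<close>

lemma recognisable_ex: "recognisable {c. \<exists>n. P (c n)}"
proof (rule recognisableI[where A = UNIV and f = "\<lambda>w. \<exists>i<length w. P (w ! i)"])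
  show "contexts {c. \<exists>n. P (c n)} w =
      (\<lambda>b. {(l, r). (\<exists>n<0. P (l n)) \<or> b \<or> (\<exists>j. P (r j))}) (\<exists>i<length w. P (w ! i))" for w
    by (simp add: contexts_def ex_biword[of "\<lambda>n. P"])
qed auto

text \<open>Sorting the pair by the zones of its two positions shows that three bits about the
  factor suffice: whether it contains \<open>P\<close>, whether it contains \<open>Q\<close>, and
  whether it contains \<open>P\<close> before \<open>Q\<close>.\<close>

lemma recognisable_less: "recognisable {c. \<exists>n m. n < m \<and> P (c n) \<and> Q (c m)}"
proof (rule recognisableI[where A = "UNIV :: (bool \<times> bool \<times> bool) set"])
  define h where "h = (\<lambda>(p, q, b). {(l :: int \<Rightarrow> 'a, r :: nat \<Rightarrow> 'a).
      (\<exists>n<0. \<exists>m<0. n < m \<and> P (l n) \<and> Q (l m)) \<or> (\<exists>n<0. P (l n)) \<and> (q \<or> (\<exists>j. Q (r j))) \<or>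
      b \<or> p \<and> (\<exists>j. Q (r j)) \<or> (\<exists>i j. i < j \<and> P (r i) \<and> Q (r j))})"
  show "contexts {c. \<exists>n m. n < m \<and> P (c n) \<and> Q (c m)} w =
      h (\<exists>i<length w. P (w ! i), \<exists>i<length w. Q (w ! i),
         \<exists>i<length w. \<exists>j<length w. i < j \<and> P (w ! i) \<and> Q (w ! j))" for w
  proof -
    have "(\<exists>n m. n < m \<and> P (biword l w r n) \<and> Q (biword l w r m)) \<longleftrightarrow>
        (l, r) \<in> h (\<exists>i<length w. P (w ! i), \<exists>i<length w. Q (w ! i),
         \<exists>i<length w. \<exists>j<length w. i < j \<and> P (w ! i) \<and> Q (w ! j))" for l r
    proof -
      have *: "(\<exists>m. n < m \<and> P (biword l w r n) \<and> Q (biword l w r m)) \<longleftrightarrow>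
          P (biword l w r n) \<and> ((\<exists>m<0. n < m \<and> Q (l m)) \<or> (\<exists>i<length w. n < int i \<and> Q (w ! i)) \<or>
            (\<exists>j. n < int (length w + j) \<and> Q (r j)))" for n
        using ex_biword[of "\<lambda>m a. n < m \<and> Q a" l w r] by blast
      show ?thesis
        unfolding * ex_biword[of "\<lambda>n a. P a \<and> ((\<exists>m<0. n < m \<and> Q (l m)) \<or>
            (\<exists>i<length w. n < int i \<and> Q (w ! i)) \<or> (\<exists>j. n < int (length w + j) \<and> Q (r j)))" l w r]
          h_def
        by (auto; (force)?)
    qed
    then show ?thesis by (auto simp: contexts_def)
  qed
qed simp_all

text \<open>Any bi-infinite word can be cut after \<open>k\<close> letters. The whole of
  \<open>c\<close> serves as left context because only its negative part is read.\<close>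

lemma biword_collapse:
  "biword c (map (\<lambda>i. c (int i)) [0..<k]) (\<lambda>j. c (int (k + j))) = c"
  by (auto simp: biword_def fun_eq_iff)

text \<open>A letter appended to the factor can be moved to the front of the right context. Hence
  the contexts of \<open>w @ [a]\<close> depend only on those of \<open>w\<close> and on
  \<open>a\<close>, which makes the automaton deterministic.\<close>

lemma biword_append1: "biword l (w @ [a]) r = biword l w (case_nat a r)"
proof
  fix n
  consider "n < 0" | i where "n = int i" "i < length w" | "n = int (length w)"
    | j where "n = int (Suc (length w + j))"
  proof (cases "n < 0")
    case False
    then obtain i where "n = int i" using nonneg_int_cases by (metis not_less)
    then show ?thesis
      using that(2)[of i] that(3) that(4)[of "i - Suc (length w)"]
      by (cases i "length w" rule: linorder_cases) auto
  qed
  then show "biword l (w @ [a]) r n = biword l w (case_nat a r) n"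
    by cases (auto simp: biword_def nth_append simp del: of_nat_add of_nat_Suc)
qed

text \<open>This is the subset construction: the contexts of \<open>w\<close> are determined by the
  set of all contexts of relabellings of \<open>w\<close>, and a finite collection of context sets
  has finitely many subsets.\<close>

lemma recognisable_letter_image:
  assumes "recognisable S"
  shows "recognisable {c. \<exists>c'\<in>S. \<forall>n. E (c n) (c' n)}"
proof (rule recognisableI)
  let ?f = "\<lambda>w. contexts S ` {w'. list_all2 E w w'}"
  let ?h = "\<lambda>X. {(l, r). \<exists>(l', r')\<in>\<Union>X. (\<forall>n<0. E (l n) (l' n)) \<and> (\<forall>j. E (r j) (r' j))}"
  show "?f w \<in> Pow (range (contexts S))" for w by blast
  show "finite (Pow (range (contexts S)))" using assms by (simp add: recognisable_def)
  show "contexts {c. \<exists>c'\<in>S. \<forall>n. E (c n) (c' n)} w = ?h (?f w)" for w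
  proof (intro equalityI subrelI)
    fix l r
    assume "(l, r) \<in> contexts {c. \<exists>c'\<in>S. \<forall>n. E (c n) (c' n)} w"
    then obtain c' where c': "c' \<in> S" "\<And>n. E (biword l w r n) (c' n)"
      by (auto simp: contexts_def)
    \<comment> \<open>The relabelled word is cut at the length of \<open>w\<close>, which yields a
      relabelling of the factor and of each context separately.\<close>
    define w' where "w' = map (\<lambda>i. c' (int i)) [0..<length w]"
    define r' where "r' = (\<lambda>j. c' (int (length w + j)))"
    have "biword c' w' r' = c'" unfolding w'_def r'_def by (rule biword_collapse)
    then have "(c', r') \<in> contexts S w'" using c'(1) by (simp add: contexts_def)
    moreover have "list_all2 E w w'"
      unfolding list_all2_conv_all_nth
    proof (intro conjI allI impI)
      fix i assume "i < length w"
      then show "E (w ! i) (w' ! i)"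
        using c'(2)[of "int i"] by (simp add: biword_def w'_def)
    qed (simp add: w'_def)
    moreover have "E (l n) (c' n)" if "n < 0" for n
      using c'(2)[of n] that by (simp add: biword_def)
    moreover have "E (r j) (r' j)" for j
      using c'(2)[of "int (length w + j)"] by (simp add: biword_def r'_def nat_add_distrib)
    ultimately show "(l, r) \<in> ?h (?f w)" by blast
  next
    fix l r
    assume "(l, r) \<in> ?h (?f w)"
    then obtain l' w' r' where *: "biword l' w' r' \<in> S" "list_all2 E w w'"
      "\<And>n. n < 0 \<Longrightarrow> E (l n) (l' n)" "\<And>j. E (r j) (r' j)"
      by (auto simp: contexts_def)
    have "E (biword l w r n) (biword l' w' r' n)" for n
      using * by (auto simp: biword_def list_all2_conv_all_nth)
    with *(1) show "(l, r) \<in> contexts {c. \<exists>c'\<in>S. \<forall>n. E (c n) (c' n)} w"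
      by (auto simp: contexts_def)
  qed
qed

text \<open>The states of the Myhill--Nerode automaton are the sets of contexts.\<close>

lemma recognisable_automaton:
  assumes "recognisable S"
  obtains st :: "'a list \<Rightarrow> nat" and \<delta> m F
  where "\<And>w. st w < m" "\<And>w a. st (w @ [a]) = \<delta> (st w) a"
    "\<And>w. st w \<in> F \<longleftrightarrow> biword l w r \<in> S"
proof -
  obtain h where h: "bij_betw h (range (contexts S)) {0..<card (range (contexts S))}"
    using ex_bij_betw_finite_nat[of "range (contexts S)"] assms
    by (auto simp: recognisable_def)
  define g where "g = inv_into (range (contexts S)) h"
  have g: "g (h (contexts S w)) = contexts S w" for w
    unfolding g_def using h by (simp add: bij_betw_def inv_into_f_f)
  let ?st = "\<lambda>w. h (contexts S w)"
  \<comment> \<open>\<open>g\<close> decodes a state number into its set of contexts. After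
    \<open>a\<close>, the remaining right contexts are those that, prefixed with \<open>a\<close>,
    were admissible before.\<close>
  let ?\<delta> = "\<lambda>q a. h {(l, r). (l, case_nat a r) \<in> g q}"
  show ?thesis
  proof (rule that[of ?st "card (range (contexts S))" ?\<delta> "{q. (l, r) \<in> g q}"])
    show "?st w < card (range (contexts S))" for w
      using h by (auto simp: bij_betw_def)
    show "?st (w @ [a]) = ?\<delta> (?st w) a" for w a
      unfolding g by (simp add: contexts_def biword_append1)
    show "?st w \<in> {q. (l, r) \<in> g q} \<longleftrightarrow> biword l w r \<in> S" for w
      by (simp add: g) (simp add: contexts_def)
  qed
qed


section \<open>First-order formulas define recognisable sets\<close>

text \<open>An interpretation and an assignment form one bi-infinite word, in which the variable \<open>x\<close> is a
  further predicate that holds only at \<open>e x\<close>.\<close>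

type_synonym track = "acon + var"

definition word_of :: "acon set \<Rightarrow> var set \<Rightarrow> interp \<Rightarrow> (var \<Rightarrow> int) \<Rightarrow> int \<Rightarrow> track set" where
  "word_of K V M e n = Inl ` {A\<in>K. n \<in> M A} \<union> Inr ` {x\<in>V. e x = n}"

lemma Inl_in_word_of [simp]: "Inl A \<in> word_of K V M e n \<longleftrightarrow> A \<in> K \<and> n \<in> M A"
  and Inr_in_word_of [simp]: "Inr x \<in> word_of K V M e n \<longleftrightarrow> x \<in> V \<and> e x = n"
  by (auto simp: word_of_def)

lemma track_set_eqI:
  assumes "\<And>A. Inl A \<in> X \<longleftrightarrow> Inl A \<in> Y" "\<And>x. Inr x \<in> X \<longleftrightarrow> Inr x \<in> Y"
  shows "X = (Y :: track set)"
proof (rule set_eqI)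
  show "\<tau> \<in> X \<longleftrightarrow> \<tau> \<in> Y" for \<tau> using assms by (cases \<tau>) auto
qed

text \<open>\<open>S\<close> is constrained only on words that encode an interpretation with an
  assignment. Words whose variable tracks are not singletons may belong to it or not, so
  quantification has to exclude them explicitly.\<close>

definition definable :: "acon set \<Rightarrow> var set \<Rightarrow> (interp \<Rightarrow> (var \<Rightarrow> int) \<Rightarrow> bool) \<Rightarrow> bool" where
  "definable K V P \<longleftrightarrow> (\<exists>S. recognisable S \<and> (\<forall>M e. word_of K V M e \<in> S \<longleftrightarrow> P M e))"

lemma definableI:
  "recognisable S \<Longrightarrow> (\<And>M e. word_of K V M e \<in> S \<longleftrightarrow> P M e) \<Longrightarrow> definable K V P"
  unfolding definable_def by blast

lemma definable_pred:
  assumes "A \<in> K" "t \<in> V"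
  shows "definable K V (\<lambda>M e. e t \<in> M A)"
  by (rule definableI[OF recognisable_ex[of "\<lambda>a. Inl A \<in> a \<and> Inr t \<in> a"]]) (use assms in auto)

lemma definable_eq:
  assumes "t \<in> V" "t' \<in> V"
  shows "definable K V (\<lambda>M e. e t = e t')"
  by (rule definableI[OF recognisable_ex[of "\<lambda>a. Inr t \<in> a \<and> Inr t' \<in> a"]]) (use assms in auto)

lemma definable_less:
  assumes "t \<in> V" "t' \<in> V"
  shows "definable K V (\<lambda>M e. e t < e t')"
  by (rule definableI[OF recognisable_less[of "\<lambda>a. Inr t \<in> a" "\<lambda>a. Inr t' \<in> a"]])
     (use assms in auto)

lemma definable_not: "definable K V P \<Longrightarrow> definable K V (\<lambda>M e. \<not> P M e)"
  unfolding definable_def using recognisable_Compl by (metis ComplI ComplD)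

lemma definable_conj:
  "definable K V P \<Longrightarrow> definable K V Q \<Longrightarrow> definable K V (\<lambda>M e. P M e \<and> Q M e)"
  unfolding definable_def using recognisable_Int by (metis Int_iff)

text \<open>The value of \<open>x\<close> is guessed by relabelling the track of \<open>x\<close>,
  after \<open>S\<close> has been restricted to words in which this track is a singleton.\<close>

lemma definable_ex:
  assumes "definable K (insert x V) P"
  shows "definable K V (\<lambda>M e. \<exists>n. P M (e(x := n)))"
proof -
  obtain S where S: "recognisable S" "\<And>M e. word_of K (insert x V) M e \<in> S \<longleftrightarrow> P M e"
    using assms by (auto simp: definable_def)
  \<comment> \<open>Exactly one position carries \<open>x\<close>: some position does, and no two
    different ones do.\<close>
  let ?sing = "{c. \<exists>n. Inr x \<in> c n} \<inter> - {c. \<exists>n m. n < m \<and> Inr x \<in> c n \<and> Inr x \<in> c m}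
    :: (int \<Rightarrow> track set) set"
  \<comment> \<open>Both sides forget the track of \<open>x\<close>, so an old value of
    \<open>x\<close> is overwritten if \<open>x\<close> already belongs to \<open>V\<close>.\<close>
  let ?E = "\<lambda>a b :: track set. a - {Inr x} = b - {Inr x}"
  have rec: "recognisable {c. \<exists>c'\<in>S \<inter> ?sing. \<forall>n. ?E (c n) (c' n)}"
    by (intro recognisable_letter_image recognisable_Int recognisable_Compl S(1)
        recognisable_less recognisable_ex)
  show ?thesis
  proof (rule definableI[OF rec])
    fix M e
    show "word_of K V M e \<in> {c. \<exists>c'\<in>S \<inter> ?sing. \<forall>n. ?E (c n) (c' n)} \<longleftrightarrow> (\<exists>n. P M (e(x := n)))"
    proof
      assume "word_of K V M e \<in> {c. \<exists>c'\<in>S \<inter> ?sing. \<forall>n. ?E (c n) (c' n)}"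
      then obtain c' where c': "c' \<in> S" "c' \<in> ?sing" "\<And>n. ?E (word_of K V M e n) (c' n)"
        by blast
      from c'(2) obtain k where k: "\<And>n. Inr x \<in> c' n \<longleftrightarrow> n = k"
        by simp (metis linorder_neqE)
      have "word_of K (insert x V) M (e(x := k)) = c'"
      proof
        fix n
        have *: "\<tau> \<in> c' n \<longleftrightarrow> \<tau> \<in> word_of K V M e n" if "\<tau> \<noteq> Inr x" for \<tau>
          using c'(3)[of n] that by blast
        show "word_of K (insert x V) M (e(x := k)) n = c' n"
        proof (rule track_set_eqI)
          show "Inr y \<in> word_of K (insert x V) M (e(x := k)) n \<longleftrightarrow> Inr y \<in> c' n" for y
            by (cases "y = x") (auto simp: k *)
        qed (simp add: *)
      qed
      with c'(1) S(2) show "\<exists>n. P M (e(x := n))" by metis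
    next
      assume "\<exists>n. P M (e(x := n))"
      then obtain k where "word_of K (insert x V) M (e(x := k)) \<in> S"
        by (auto simp: S(2))
      moreover have "word_of K (insert x V) M (e(x := k)) \<in> ?sing" by auto
      moreover have "?E (word_of K V M e n) (word_of K (insert x V) M (e(x := k)) n)" for n
        by (rule track_set_eqI) auto
      ultimately show "word_of K V M e \<in> {c. \<exists>c'\<in>S \<inter> ?sing. \<forall>n. ?E (c n) (c' n)}"
        by blast
    qed
  qed
qed

text \<open>Over the integers, successor means being larger with nothing strictly between.
  Finiteness of \<open>V\<close> provides a fresh variable for the point in between.\<close>

lemma definable_suc:
  assumes "t \<in> V" "t' \<in> V" "finite V"
  shows "definable K V (\<lambda>M e. e t = e t' + 1)"
proof -
  obtain x where "x \<notin> V" using assms(3) ex_new_if_finite infinite_UNIV_nat by blast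
  then have "x \<noteq> t" "x \<noteq> t'" using assms by auto
  then have eq: "(\<lambda>(M :: interp) e. e t = e t' + 1) =
      (\<lambda>M e. e t' < e t \<and> \<not> (\<exists>n::int. (e(x := n)) t' < (e(x := n)) x \<and> (e(x := n)) x < (e(x := n)) t))"
  proof -
    have "a = b + 1 \<longleftrightarrow> b < a \<and> \<not> (\<exists>n. b < n \<and> n < a)" for a b :: int
      by presburger
    then show ?thesis using \<open>x \<noteq> t\<close> \<open>x \<noteq> t'\<close> by (simp add: fun_eq_iff)
  qed
  show ?thesis
    unfolding eq
    by (intro definable_conj definable_less definable_not
        definable_ex[where P = "\<lambda>M e. e t' < e x \<and> e x < e t"]) (use assms in auto)
qed

primrec mfo_acons :: "mfo \<Rightarrow> acon set" where
  "mfo_acons (MPred A t) = {A}"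
| "mfo_acons (MLess t t') = {}"
| "mfo_acons (MEq t t') = {}"
| "mfo_acons (MSuc t t') = {}"
| "mfo_acons (MNeg \<phi>) = mfo_acons \<phi>"
| "mfo_acons (MConj \<phi> \<psi>) = mfo_acons \<phi> \<union> mfo_acons \<psi>"
| "mfo_acons (MEx x \<phi>) = mfo_acons \<phi>"

lemma finite_mfo_acons: "finite (mfo_acons \<phi>)"
  by (induction \<phi>) auto

text \<open>The set \<open>V\<close> of tracks varies in the induction because the body of a
  quantifier needs one more track.\<close>

lemma definable_mfo:
  "mfo_acons \<phi> \<subseteq> K \<Longrightarrow> mfo_fv \<phi> \<subseteq> V \<Longrightarrow> finite V \<Longrightarrow> definable K V (\<lambda>M e. mfo_sat M e \<phi>)"
proof (induction \<phi> arbitrary: V)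
  case (MEx x \<phi>)
  then have "mfo_fv \<phi> \<subseteq> insert x V" by auto
  with MEx have "definable K (insert x V) (\<lambda>M e. mfo_sat M e \<phi>)" by simp
  then show ?case using definable_ex[of K x V "\<lambda>M e. mfo_sat M e \<phi>"] by simp
qed (auto intro: definable_pred definable_eq definable_less definable_suc
       definable_not definable_conj)


section \<open>Ontologies as first-order sentences\<close>

text \<open>The standard translation. Each operator moves on to the variable \<open>Suc x\<close>,
  and the translation of the argument has only that variable free, so no capture occurs.\<close>

primrec mfo_of_concept :: "tconcept \<Rightarrow> var \<Rightarrow> mfo" where
  "mfo_of_concept (Atomic A) x = MPred A x"
| "mfo_of_concept (BoxF C) x =
     MNeg (MEx (Suc x) (MConj (MLess x (Suc x)) (MNeg (mfo_of_concept C (Suc x)))))"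
| "mfo_of_concept (BoxP C) x =
     MNeg (MEx (Suc x) (MConj (MLess (Suc x) x) (MNeg (mfo_of_concept C (Suc x)))))"
| "mfo_of_concept (NextF C) x =
     MEx (Suc x) (MConj (MSuc (Suc x) x) (mfo_of_concept C (Suc x)))"
| "mfo_of_concept (NextP C) x =
     MEx (Suc x) (MConj (MSuc x (Suc x)) (mfo_of_concept C (Suc x)))"

lemma mfo_sat_concept: "mfo_sat M e (mfo_of_concept C x) \<longleftrightarrow> e x \<in> ext M C"
proof (induction C arbitrary: e x)
  case (NextP C)
  have "(\<exists>n. e x = n + 1 \<and> n \<in> ext M C) \<longleftrightarrow> e x - 1 \<in> ext M C"
    by (metis add_diff_cancel_right' diff_add_cancel)
  with NextP show ?case by simp
qed auto

lemma mfo_fv_concept: "mfo_fv (mfo_of_concept C x) = {x}"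
  by (induction C arbitrary: x) auto

primrec mfo_conjs :: "mfo list \<Rightarrow> mfo" where
  "mfo_conjs [] = MNeg (MEx 0 (MLess 0 0))"
| "mfo_conjs (\<phi> # \<phi>s) = MConj \<phi> (mfo_conjs \<phi>s)"

lemma mfo_sat_conjs: "mfo_sat M e (mfo_conjs \<phi>s) \<longleftrightarrow> (\<forall>\<phi>\<in>set \<phi>s. mfo_sat M e \<phi>)"
  and mfo_fv_conjs: "mfo_fv (mfo_conjs \<phi>s) = (\<Union>\<phi>\<in>set \<phi>s. mfo_fv \<phi>)"
  by (induction \<phi>s) auto

text \<open>The inclusion of the clause is expressed as the absence of a time point that violates
  it.\<close>

definition mfo_of_clause :: "clause \<Rightarrow> mfo" where
  "mfo_of_clause c = MNeg (MEx 0 (mfo_conjs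
     (map (\<lambda>C. mfo_of_concept C 0) (fst c) @ map (\<lambda>C. MNeg (mfo_of_concept C 0)) (snd c))))"

lemma mfo_sat_clause: "mfo_sat M e (mfo_of_clause c) \<longleftrightarrow> clause_true M c"
  by (auto simp: mfo_of_clause_def clause_true_def mfo_sat_conjs mfo_sat_concept ball_Un)

lemma mfo_fv_clause: "mfo_fv (mfo_of_clause c) = {}"
  by (auto simp: mfo_of_clause_def mfo_fv_conjs mfo_fv_concept)

lemma ontology_mfo:
  assumes "finite \<O>"
  obtains \<chi> where "mfo_fv \<chi> = {}" "\<And>M e. mfo_sat M e \<chi> \<longleftrightarrow> (\<forall>c\<in>\<O>. clause_true M c)"
proof -
  obtain cs where cs: "set cs = \<O>" using finite_list[OF assms] by blast
  show ?thesis
    by (rule that[of "mfo_conjs (map mfo_of_clause cs)"])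
       (simp_all add: mfo_fv_conjs mfo_fv_clause mfo_sat_conjs mfo_sat_clause cs)
qed


section \<open>Certain answers are recognised by an automaton\<close>

definition data_word ::
  "acon set \<Rightarrow> var set \<Rightarrow> interp \<Rightarrow> (var \<Rightarrow> int) \<Rightarrow> nat \<Rightarrow> track set list" where
  "data_word K V I e k = map (\<lambda>i. word_of K V I e (int i)) [0..<k]"

lemma data_word_0 [simp]: "data_word K V I e 0 = []"
  and data_word_Suc:
    "data_word K V I e (Suc k) = data_word K V I e k @ [word_of K V I e (int k)]"
  by (simp_all add: data_word_def)

lemma tem_data_instance:
  assumes "data_instance \<A>"
  obtains N where "tem \<A> = {0..int N}"
proof (rule that)
  show "tem \<A> = {0..int (nat (Max (snd ` \<A>)))}"
    using assms by (simp add: data_instance_def tem_def)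
qed

lemma data_in_tem:
  assumes "data_instance \<A>" "(A, l) \<in> \<A>"
  shows "l \<in> tem \<A>"
proof -
  have "l \<in> snd ` \<A>" using assms(2) by force
  with assms(1) have "Min (snd ` \<A>) \<le> l" "l \<le> Max (snd ` \<A>)"
    unfolding data_instance_def by (blast intro: Min_le Max_ge finite_imageI)+
  then show ?thesis by (simp add: tem_def)
qed

lemma assign_in_set:
  assumes "length ls = length ts" "x \<in> set ts"
  shows "assign ts ls x \<in> set ls"
proof -
  obtain a where a: "map_of (zip ts ls) x = Some a"
    using assms by (metis map_of_zip_is_Some)
  then have "a \<in> set ls" using map_of_SomeD set_zip_rightD by metis
  then show ?thesis by (simp add: assign_def upds_def a)
qed

text \<open>Data atoms and candidate answers all lie in the domain, so outside it the letters are
  blank and the finite word determines the whole bi-infinite one.\<close>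

lemma biword_data_word:
  assumes "\<And>n. n \<notin> {0..int N} \<Longrightarrow> word_of K V I e n = {}"
  shows "biword (\<lambda>_. {}) (data_word K V I e (Suc N)) (\<lambda>_. {}) = word_of K V I e"
proof
  fix n
  show "biword (\<lambda>_. {}) (data_word K V I e (Suc N)) (\<lambda>_. {}) n = word_of K V I e n"
  proof (cases "n \<in> {0..int N}")
    case True
    then have "nat n < Suc N" "\<not> n < 0" by auto
    then show ?thesis by (simp add: biword_def data_word_def del: upt_Suc)
  next
    case False
    then have "n < 0 \<or> \<not> nat n < Suc N" by auto
    with assms[OF False] show ?thesis by (auto simp: biword_def data_word_def)
  qed
qed

text \<open>The models of the data are exactly what is obtained from its word by adding concept tracks
  to the letters, so that guessing a model is taking a letter image.\<close>

lemma certain_answer_automaton: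
  assumes "is_omq (\<O>, \<psi>, ts)"
  obtains As :: "acon list" and st :: "track set list \<Rightarrow> nat" and \<delta> m F
  where "\<And>w. st w < m" "\<And>w a. st (w @ [a]) = \<delta> (st w) a"
    "\<And>\<A> ls N. data_instance \<A> \<Longrightarrow> length ls = length ts \<Longrightarrow> set ls \<subseteq> tem \<A> \<Longrightarrow>
        tem \<A> = {0..int N} \<Longrightarrow>
        certain_answer (\<O>, \<psi>, ts) \<A> ls \<longleftrightarrow>
        st (data_word (set As) (set ts) (data_interp \<A>) (assign ts ls) (Suc N)) \<in> F"
proof -
  let ?V = "set ts"
  from assms have omq: "finite \<O>" "mfo_fv \<psi> = ?V" by auto
  obtain \<chi> where \<chi>: "mfo_fv \<chi> = {}" "\<And>M e. mfo_sat M e \<chi> \<longleftrightarrow> (\<forall>c\<in>\<O>. clause_true M c)"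
    using ontology_mfo[OF omq(1)] by blast
  \<comment> \<open>A model of \<open>\<phi>\<close> is a model of the ontology that refutes the
    query. The data enter only later, through the relabelling \<open>E\<close>.\<close>
  define \<phi> where "\<phi> = MConj \<chi> (MNeg \<psi>)"
  obtain As where As: "set As = mfo_acons \<phi>" using finite_list[OF finite_mfo_acons] by blast
  let ?K = "set As"
  have "definable ?K ?V (\<lambda>M e. mfo_sat M e \<phi>)"
    by (rule definable_mfo) (use \<chi>(1) omq in \<open>auto simp: As \<phi>_def\<close>)
  then obtain S where S: "recognisable S" "\<And>M e. word_of ?K ?V M e \<in> S \<longleftrightarrow> mfo_sat M e \<phi>"
    by (auto simp: definable_def)
  \<comment> \<open>A guessed letter keeps all data atoms and may add concepts, also outside the
    data domain. The variable tracks are left unchanged, which fixes the candidate answer.\<close>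
  define E :: "track set \<Rightarrow> track set \<Rightarrow> bool" where
    "E = (\<lambda>a b. a \<subseteq> b \<and> b \<subseteq> a \<union> Inl ` ?K)"
  let ?S' = "{c. \<exists>c'\<in>S. \<forall>n. E (c n) (c' n)}"
  show ?thesis
  proof (rule recognisable_automaton[OF recognisable_letter_image[OF S(1)],
        where E1 = E and l = "\<lambda>_. {}" and r = "\<lambda>_. {}"])
    fix st :: "track set list \<Rightarrow> nat" and \<delta> m F
    assume st: "\<And>w. st w < m" "\<And>w a. st (w @ [a]) = \<delta> (st w) a"
      "\<And>w. st w \<in> F \<longleftrightarrow> biword (\<lambda>_. {}) w (\<lambda>_. {}) \<in> ?S'"
    show thesis
    \<comment> \<open>\<open>F\<close> accepts if there is a countermodel; certain answers are the
      complement.\<close>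
    proof (rule that[of st m \<delta> As "- F"])
      fix \<A> ls N
      assume \<A>: "data_instance \<A>" "length ls = length ts" "set ls \<subseteq> tem \<A>" "tem \<A> = {0..int N}"
      let ?I = "data_interp \<A>" and ?e = "assign ts ls"
      have "word_of ?K ?V ?I ?e n = {}" if n: "n \<notin> {0..int N}" for n
      proof -
        have "n \<notin> ?I A" for A using that \<A>(1,4) data_in_tem by (auto simp: data_interp_def)
        moreover have "?e x \<noteq> n" if x: "x \<in> ?V" for x
          using assign_in_set[OF \<A>(2) x] \<A>(3,4) n by blast
        ultimately show ?thesis by (auto simp: word_of_def)
      qed
      then have "biword (\<lambda>_. {}) (data_word ?K ?V ?I ?e (Suc N)) (\<lambda>_. {}) = word_of ?K ?V ?I ?e"
        by (rule biword_data_word)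
      then have "st (data_word ?K ?V ?I ?e (Suc N)) \<in> F \<longleftrightarrow> word_of ?K ?V ?I ?e \<in> ?S'"
        by (simp only: st(3))
      also have "\<dots> \<longleftrightarrow> (\<exists>M. model_of M \<O> \<A> \<and> \<not> mfo_sat M ?e \<psi>)"
      proof
        assume "word_of ?K ?V ?I ?e \<in> ?S'"
        then obtain c where c: "c \<in> S" "\<And>n. E (word_of ?K ?V ?I ?e n) (c n)" by blast
        \<comment> \<open>Concepts outside \<open>As\<close> have no track. Interpreting them by the
          data itself satisfies their data atoms and does not change the word.\<close>
        define M where "M = (\<lambda>A. if A \<in> ?K then {n. Inl A \<in> c n} else ?I A)"
        have "word_of ?K ?V M ?e = c"
        proof
          fix n
          show "word_of ?K ?V M ?e n = c n"
          proof (rule track_set_eqI)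
            show "Inl A \<in> word_of ?K ?V M ?e n \<longleftrightarrow> Inl A \<in> c n" for A
              using c(2)[of n] by (auto simp: E_def M_def)
            have "Inr x \<in> word_of ?K ?V ?I ?e n \<longleftrightarrow> Inr x \<in> c n" for x
              using c(2)[of n] unfolding E_def by blast
            then show "Inr x \<in> word_of ?K ?V M ?e n \<longleftrightarrow> Inr x \<in> c n" for x
              by simp
          qed
        qed
        with c(1) S(2) have "mfo_sat M ?e \<phi>" by metis
        moreover have "l \<in> M A" if "(A, l) \<in> \<A>" for A l
        proof (cases "A \<in> ?K")
          case True
          then have "Inl A \<in> word_of ?K ?V ?I ?e l" using that by (simp add: data_interp_def)
          then show ?thesis using c(2)[of l] True by (auto simp: E_def M_def)
        qed (use that in \<open>simp add: M_def data_interp_def\<close>)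
        ultimately show "\<exists>M. model_of M \<O> \<A> \<and> \<not> mfo_sat M ?e \<psi>"
          by (auto simp: \<phi>_def \<chi>(2) model_of_def)
      next
        assume "\<exists>M. model_of M \<O> \<A> \<and> \<not> mfo_sat M ?e \<psi>"
        then obtain M where M: "model_of M \<O> \<A>" "\<not> mfo_sat M ?e \<psi>" by blast
        then have "word_of ?K ?V M ?e \<in> S"
          by (auto simp: S(2) \<phi>_def \<chi>(2) model_of_def)
        moreover have "E (word_of ?K ?V ?I ?e n) (word_of ?K ?V M ?e n)" for n
          using M(1) by (auto simp: E_def word_of_def model_of_def data_interp_def)
        ultimately show "word_of ?K ?V ?I ?e \<in> ?S'" by blast
      qed
      finally show "certain_answer (\<O>, \<psi>, ts) \<A> ls \<longleftrightarrow>
          st (data_word ?K ?V ?I ?e (Suc N)) \<in> - F"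
        using \<A>(2,3) by auto
    qed (fact st)+
  qed
qed


section \<open>Simulating an automaton\<close>

definition rfalse :: rpr where
  "rfalse = REx 0 (RNeg (REq 0 0))"

lemma rfalse [simp]:
  "\<not> rpr_sat D I rfalse e \<rho>" "rpr_fv rfalse = {}" "rec_vars rfalse = []" "wf_rpr G P rfalse"
  by (simp_all add: rfalse_def)

primrec rdisj :: "rpr list \<Rightarrow> rpr" where
  "rdisj [] = rfalse"
| "rdisj (\<phi> # \<phi>s) = RNeg (RConj (RNeg \<phi>) (RNeg (rdisj \<phi>s)))"

primrec rconj :: "rpr list \<Rightarrow> rpr" where
  "rconj [] = RNeg rfalse"
| "rconj (\<phi> # \<phi>s) = RConj \<phi> (rconj \<phi>s)"

lemma rdisj [simp]:
  "rpr_sat D I (rdisj \<phi>s) e \<rho> \<longleftrightarrow> (\<exists>\<phi>\<in>set \<phi>s. rpr_sat D I \<phi> e \<rho>)"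
  "rpr_fv (rdisj \<phi>s) = (\<Union>\<phi>\<in>set \<phi>s. rpr_fv \<phi>)"
  "rec_vars (rdisj \<phi>s) = concat (map rec_vars \<phi>s)"
  "wf_rpr G P (rdisj \<phi>s) \<longleftrightarrow> (\<forall>\<phi>\<in>set \<phi>s. wf_rpr G P \<phi>)"
  by (induction \<phi>s) auto

lemma rconj [simp]:
  "rpr_sat D I (rconj \<phi>s) e \<rho> \<longleftrightarrow> (\<forall>\<phi>\<in>set \<phi>s. rpr_sat D I \<phi> e \<rho>)"
  "rpr_fv (rconj \<phi>s) = (\<Union>\<phi>\<in>set \<phi>s. rpr_fv \<phi>)"
  "rec_vars (rconj \<phi>s) = concat (map rec_vars \<phi>s)"
  "wf_rpr G P (rconj \<phi>s) \<longleftrightarrow> (\<forall>\<phi>\<in>set \<phi>s. wf_rpr G P \<phi>)"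
  by (induction \<phi>s) auto

primrec sdisj :: "mso list \<Rightarrow> mso" where
  "sdisj [] = SEx 0 (SLess 0 0)"
| "sdisj (\<phi> # \<phi>s) = SNeg (SConj (SNeg \<phi>) (SNeg (sdisj \<phi>s)))"

primrec sconj :: "mso list \<Rightarrow> mso" where
  "sconj [] = SNeg (SEx 0 (SLess 0 0))"
| "sconj (\<phi> # \<phi>s) = SConj \<phi> (sconj \<phi>s)"

lemma sdisj [simp]:
  "mso_sat D I e \<sigma> (sdisj \<phi>s) \<longleftrightarrow> (\<exists>\<phi>\<in>set \<phi>s. mso_sat D I e \<sigma> \<phi>)"
  "mso_fv (sdisj \<phi>s) = (\<Union>\<phi>\<in>set \<phi>s. mso_fv \<phi>)"
  "mso_setfv (sdisj \<phi>s) = (\<Union>\<phi>\<in>set \<phi>s. mso_setfv \<phi>)"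
  by (induction \<phi>s) auto

lemma sconj [simp]:
  "mso_sat D I e \<sigma> (sconj \<phi>s) \<longleftrightarrow> (\<forall>\<phi>\<in>set \<phi>s. mso_sat D I e \<sigma> \<phi>)"
  "mso_fv (sconj \<phi>s) = (\<Union>\<phi>\<in>set \<phi>s. mso_fv \<phi>)"
  "mso_setfv (sconj \<phi>s) = (\<Union>\<phi>\<in>set \<phi>s. mso_setfv \<phi>)"
  by (induction \<phi>s) auto

definition siff :: "mso \<Rightarrow> mso \<Rightarrow> mso" where
  "siff \<phi> \<psi> = SConj (SNeg (SConj \<phi> (SNeg \<psi>))) (SNeg (SConj \<psi> (SNeg \<phi>)))"

lemma siff [simp]:
  "mso_sat D I e \<sigma> (siff \<phi> \<psi>) \<longleftrightarrow> (mso_sat D I e \<sigma> \<phi> \<longleftrightarrow> mso_sat D I e \<sigma> \<psi>)"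
  "mso_fv (siff \<phi> \<psi>) = mso_fv \<phi> \<union> mso_fv \<psi>"
  "mso_setfv (siff \<phi> \<psi>) = mso_setfv \<phi> \<union> mso_setfv \<psi>"
  by (auto simp: siff_def)

primrec sex_sets :: "nat \<Rightarrow> mso \<Rightarrow> mso" where
  "sex_sets 0 \<phi> = \<phi>"
| "sex_sets (Suc m) \<phi> = sex_sets m (SExSet m \<phi>)"

lemma mso_fv_sex_sets: "mso_fv (sex_sets m \<phi>) = mso_fv \<phi>"
  by (induction m arbitrary: \<phi>) auto

lemma mso_setfv_sex_sets: "mso_setfv (sex_sets m \<phi>) = mso_setfv \<phi> - {..<m}"
  by (induction m arbitrary: \<phi>) auto

text \<open>Variable \<open>m\<close> is quantified innermost, so the set chosen for it overrides
  entry \<open>m\<close> of the family given by the induction hypothesis.\<close>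

lemma mso_sat_sex_sets:
  "mso_sat D I e \<sigma> (sex_sets m \<phi>) \<longleftrightarrow>
     (\<exists>\<tau>. (\<forall>X<m. \<tau> X \<subseteq> D) \<and> mso_sat D I e (\<lambda>X. if X < m then \<tau> X else \<sigma> X) \<phi>)"
proof (induction m arbitrary: \<phi>)
  case (Suc m)
  have "mso_sat D I e \<sigma> (sex_sets (Suc m) \<phi>) \<longleftrightarrow>
      (\<exists>\<tau> S. (\<forall>X<m. \<tau> X \<subseteq> D) \<and> S \<subseteq> D \<and>
        mso_sat D I e ((\<lambda>X. if X < m then \<tau> X else \<sigma> X)(m := S)) \<phi>)"
    by (auto simp: Suc.IH)
  also have "\<dots> \<longleftrightarrow>
      (\<exists>\<tau>. (\<forall>X<Suc m. \<tau> X \<subseteq> D) \<and> mso_sat D I e (\<lambda>X. if X < Suc m then \<tau> X else \<sigma> X) \<phi>)"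
  proof (intro iffI; elim exE conjE)
    fix \<tau> S
    assume *: "\<forall>X<m. \<tau> X \<subseteq> D" "S \<subseteq> D"
      "mso_sat D I e ((\<lambda>X. if X < m then \<tau> X else \<sigma> X)(m := S)) \<phi>"
    have "(\<lambda>X. if X < Suc m then (\<tau>(m := S)) X else \<sigma> X) =
        (\<lambda>X. if X < m then \<tau> X else \<sigma> X)(m := S)"
      by (auto simp: fun_eq_iff)
    with * show "\<exists>\<tau>. (\<forall>X<Suc m. \<tau> X \<subseteq> D) \<and>
        mso_sat D I e (\<lambda>X. if X < Suc m then \<tau> X else \<sigma> X) \<phi>"
      by (intro exI[of _ "\<tau>(m := S)"]) (auto simp: less_Suc_eq)
  next
    fix \<tau>
    assume *: "\<forall>X<Suc m. \<tau> X \<subseteq> D" "mso_sat D I e (\<lambda>X. if X < Suc m then \<tau> X else \<sigma> X) \<phi>"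
    have "(\<lambda>X. if X < Suc m then \<tau> X else \<sigma> X) =
        (\<lambda>X. if X < m then \<tau> X else \<sigma> X)(m := \<tau> m)"
      by (auto simp: fun_eq_iff)
    with * show "\<exists>\<tau> S. (\<forall>X<m. \<tau> X \<subseteq> D) \<and> S \<subseteq> D \<and>
        mso_sat D I e ((\<lambda>X. if X < m then \<tau> X else \<sigma> X)(m := S)) \<phi>"
      by (intro exI[of _ \<tau>] exI[of _ "\<tau> m"]) auto
  qed
  finally show ?case .
qed simp

text \<open>The common input of both simulations. In the formulas, \<open>t\<close> is the time
  point being read and \<open>y\<close>, \<open>z\<close> are auxiliary points; freshness keeps them
  from clashing with the answer variables that the letters mention.\<close>

locale word_automaton =
  fixes As :: "acon list" and ts :: "var list" and st :: "track set list \<Rightarrow> nat"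
    and \<delta> :: "nat \<Rightarrow> track set \<Rightarrow> nat" and m :: nat and F :: "nat set" and t y z :: var
  assumes distinct_ts: "distinct ts"
    and st_less: "st w < m"
    and st_snoc: "st (w @ [a]) = \<delta> (st w) a"
    and fresh: "t \<notin> set ts" "y \<notin> set ts" "z \<notin> set ts" "t \<noteq> y" "t \<noteq> z" "y \<noteq> z"
begin

definition tracks :: "track list" where
  "tracks = map Inl As @ map Inr ts"

text \<open>The type of letters is infinite, but only subsets of \<open>tracks\<close> occur, so the
  transitions into \<open>s\<close> form a finite list over which a disjunction can be
  taken.\<close>

definition transitions :: "nat \<Rightarrow> (nat \<times> track set) list" where
  "transitions s = filter (\<lambda>(q, a). \<delta> q a = s) (List.product [0..<m] (map set (subseqs tracks)))"

lemma set_transitions: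
  "set (transitions s) = {(q, a). q < m \<and> a \<subseteq> set tracks \<and> \<delta> q a = s}"
  using subseqs_powset[of tracks] by (auto simp: transitions_def)

abbreviation letter :: "interp \<Rightarrow> (var \<Rightarrow> int) \<Rightarrow> int \<Rightarrow> track set" where
  "letter \<equiv> word_of (set As) (set ts)"

abbreviation prefix_state :: "interp \<Rightarrow> (var \<Rightarrow> int) \<Rightarrow> nat \<Rightarrow> nat" where
  "prefix_state I e k \<equiv> st (data_word (set As) (set ts) I e k)"

lemma letter_subset: "letter I e n \<subseteq> set tracks"
  by (auto simp: word_of_def tracks_def)

lemma ex_transition:
  "(\<exists>(q, a)\<in>set (transitions s). letter I e (int k) = a \<and> prefix_state I e k = q) \<longleftrightarrow>
     prefix_state I e (Suc k) = s"
  by (auto simp: set_transitions data_word_Suc st_snoc st_less letter_subset)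

lemma letter_eqI:
  assumes "a \<subseteq> set tracks"
  shows "(\<forall>\<tau>\<in>set tracks. \<tau> \<in> a \<longleftrightarrow> \<tau> \<in> letter I e n) \<longleftrightarrow> letter I e n = a"
  using assms letter_subset[of I e n] by blast


subsection \<open>Relational primitive recursion\<close>

definition rtrack :: "track \<Rightarrow> rpr" where
  "rtrack \<tau> = (case \<tau> of Inl A \<Rightarrow> RPred A t | Inr x \<Rightarrow> REq t x)"

definition rletter :: "track set \<Rightarrow> rpr" where
  "rletter a = rconj (map (\<lambda>\<tau>. if \<tau> \<in> a then rtrack \<tau> else RNeg (rtrack \<tau>)) tracks)"

text \<open>At time 0 the recursion supplies falsity instead of the initial state.\<close>

definition rprev :: "nat \<Rightarrow> rpr" where
  "rprev q = (if q = st [] then rdisj [RNeg (REx y (RSuc t y)), RPrev q ts t] else RPrev q ts t)"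

definition rstep :: "nat \<Rightarrow> rpr" where
  "rstep s = rdisj (map (\<lambda>(q, a). RConj (rletter a) (rprev q)) (transitions s))"

text \<open>Relation variable \<open>s\<close> stands for state \<open>s\<close>: it holds at
  \<open>t\<close> if the automaton is in \<open>s\<close> after reading the letters at 0, ...,
  \<open>t\<close>. The answer variables are parameters of the recursion because the letters depend
  on them. The point \<open>z\<close> without a successor is the end of the data.\<close>

definition rpr_formula :: rpr where
  "rpr_formula = RRec (map (\<lambda>s. (s, ts, rstep s)) [0..<m]) t
     (REx z (RConj (RNeg (REx y (RSuc y z)))
       (rdisj (map (\<lambda>s. RRel s ts z) (filter (\<lambda>s. s \<in> F) [0..<m])))))"

lemma rtrack_sat:
  "\<tau> \<in> set tracks \<Longrightarrow> rpr_sat D I (rtrack \<tau>) (e(t := n)) \<rho> \<longleftrightarrow> \<tau> \<in> letter I e n"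
  using fresh(1) by (auto simp: rtrack_def tracks_def split: if_splits)

lemma rletter_sat:
  assumes "a \<subseteq> set tracks"
  shows "rpr_sat D I (rletter a) (e(t := n)) \<rho> \<longleftrightarrow> letter I e n = a"
proof -
  have "rpr_sat D I (if \<tau> \<in> a then rtrack \<tau> else RNeg (rtrack \<tau>)) (e(t := n)) \<rho> \<longleftrightarrow>
      (\<tau> \<in> a \<longleftrightarrow> \<tau> \<in> letter I e n)" if "\<tau> \<in> set tracks" for \<tau>
    using rtrack_sat[OF that] by simp
  then show ?thesis
    unfolding letter_eqI[OF assms, symmetric] rletter_def rconj set_map ball_simps(9) by blast
qed

lemma map_upd_ts: "x \<notin> set ts \<Longrightarrow> map (e(x := n)) ts = map e ts"
  by auto

text \<open>The premise on \<open>\<rho>\<close> describes stage \<open>k\<close> of the recursion: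
  correct at times below \<open>k\<close> and false elsewhere, in particular at -1, where the
  disjunct for the first point takes over.\<close>

lemma rprev_sat:
  assumes "k \<le> N" "q < m"
    and "\<And>s i. s < m \<Longrightarrow>
      \<rho> s (map e ts) i \<longleftrightarrow> 0 \<le> i \<and> i < int k \<and> prefix_state I e (Suc (nat i)) = s"
  shows "rpr_sat {0..int N} I (rprev q) (e(t := int k)) \<rho> \<longleftrightarrow> prefix_state I e k = q"
proof -
  have first: "(\<forall>n\<in>{0..int N}. int k \<noteq> n + 1) \<longleftrightarrow> k = 0"
  proof
    assume *: "\<forall>n\<in>{0..int N}. int k \<noteq> n + 1"
    show "k = 0"
    proof (rule ccontr)
      assume "k \<noteq> 0"
      with assms(1) have "int k - 1 \<in> {0..int N}" by auto
      with * show False by fastforce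
    qed
  qed auto
  have "\<rho> q (map e ts) (int k - 1) \<longleftrightarrow> k \<noteq> 0 \<and> prefix_state I e k = q"
    using assms(3)[OF assms(2), of "int k - 1"] by (cases k) auto
  then show ?thesis
    using fresh(1,4) by (auto simp: rprev_def map_upd_ts first)
qed

lemma rstep_sat:
  assumes "k \<le> N"
    and "\<And>s i. s < m \<Longrightarrow>
      \<rho> s (map e ts) i \<longleftrightarrow> 0 \<le> i \<and> i < int k \<and> prefix_state I e (Suc (nat i)) = s"
  shows "rpr_sat {0..int N} I (rstep s) (e(t := int k)) \<rho> \<longleftrightarrow> prefix_state I e (Suc k) = s"
proof -
  have prev: "rpr_sat {0..int N} I (rprev q) (e(t := int k)) \<rho> \<longleftrightarrow> prefix_state I e k = q"
    if "q < m" for q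
    by (rule rprev_sat) (use assms that in auto)
  have "rpr_sat {0..int N} I (rstep s) (e(t := int k)) \<rho> \<longleftrightarrow>
      (\<exists>(q, a)\<in>set (transitions s). letter I e (int k) = a \<and> prefix_state I e k = q)"
    unfolding rstep_def rdisj set_map bex_simps(7)
    by (intro bex_cong refl) (auto simp: rletter_sat set_transitions prev)
  then show ?thesis by (simp only: ex_transition)
qed

text \<open>The recursion is only ever applied to the current values of \<open>ts\<close>, so
  rebinding its parameters leaves the assignment unchanged.\<close>

lemma upds_map_self: "upds e ts (map e ts) = e"
  by (auto simp: upds_def fun_eq_iff map_of_zip_map)

text \<open>Stating falsity outside the computed times makes this invariant supply the premise of
  \<open>rstep_sat\<close>. The bound on \<open>k\<close> keeps every evaluated time point inside
  the domain.\<close>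

lemma rec_upto_prefix_state:
  assumes "k \<le> Suc N" "s < m"
  shows "rec_upto (map (\<lambda>s. (s, ts, rpr_sat {0..int N} I (rstep s))) [0..<m]) t e \<rho> k
      s (map e ts) i \<longleftrightarrow> 0 \<le> i \<and> i < int k \<and> prefix_state I e (Suc (nat i)) = s"
  using assms
proof (induction k arbitrary: s i)
  case 0
  then show ?case by (simp add: map_of_map_restrict)
next
  case (Suc k)
  let ?fs = "map (\<lambda>s. (s, ts, rpr_sat {0..int N} I (rstep s))) [0..<m]"
  have "rpr_sat {0..int N} I (rstep s) (e(t := int k)) (rec_upto ?fs t e \<rho> k) \<longleftrightarrow>
      prefix_state I e (Suc k) = s"
    by (rule rstep_sat) (use Suc in auto)
  with Suc show ?case
    by (auto simp: map_of_map_restrict upds_map_self)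
qed

lemma rpr_formula_sat:
  "rpr_sat {0..int N} I rpr_formula e \<rho> \<longleftrightarrow> prefix_state I e (Suc N) \<in> F"
proof -
  define \<rho>' where "\<rho>' = (\<lambda>Q as s.
      rec_upto (map (\<lambda>s. (s, ts, rpr_sat {0..int N} I (rstep s))) [0..<m]) t e \<rho>
        (nat (s + 1)) Q as s)"
  have \<rho>': "\<rho>' s (map e ts) (int N) \<longleftrightarrow> prefix_state I e (Suc N) = s" if "s < m" for s
  proof -
    \<comment> \<open>The value at time \<open>N\<close> is read off at stage \<open>N + 1\<close>,
      the first stage at which it is computed.\<close>
    have "nat (int N + 1) = Suc N" by simp
    then show ?thesis
      unfolding \<rho>'_def using rec_upto_prefix_state[of "Suc N" N s] that by simp
  qed
  have last: "n \<in> {0..int N} \<and> n + 1 \<notin> {0..int N} \<longleftrightarrow> n = int N" for n by auto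
  have defs: "map (\<lambda>(Q, z, \<theta>). (Q, z, rpr_sat {0..int N} I \<theta>))
        (map (\<lambda>s. (s, ts, rstep s)) [0..<m]) =
      map (\<lambda>s. (s, ts, rpr_sat {0..int N} I (rstep s))) [0..<m]" by simp
  have "rpr_sat {0..int N} I rpr_formula e \<rho> \<longleftrightarrow>
      rpr_sat {0..int N} I (REx z (RConj (RNeg (REx y (RSuc y z)))
        (rdisj (map (\<lambda>s. RRel s ts z) (filter (\<lambda>s. s \<in> F) [0..<m]))))) e \<rho>'"
    unfolding rpr_formula_def rpr_sat.simps(9) defs \<rho>'_def ..
  also have "\<dots> \<longleftrightarrow>
      (\<exists>n. (n \<in> {0..int N} \<and> n + 1 \<notin> {0..int N}) \<and> (\<exists>s<m. s \<in> F \<and> \<rho>' s (map e ts) n))"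
    using fresh(3,6) by (auto simp: map_upd_ts simp del: atLeastAtMost_iff)
  also have "\<dots> \<longleftrightarrow> (\<exists>s<m. s \<in> F \<and> prefix_state I e (Suc N) = s)"
    unfolding last using \<rho>' by auto
  also have "\<dots> \<longleftrightarrow> prefix_state I e (Suc N) \<in> F" using st_less by blast
  finally show ?thesis .
qed

lemma rletter_wf:
  "wf_rpr G P (rletter a)" "rec_vars (rletter a) = []" "rpr_fv (rletter a) \<subseteq> insert t (set ts)"
  by (auto simp: rletter_def rtrack_def tracks_def split: sum.splits)

lemma rprev_wf:
  "q < m \<Longrightarrow> wf_rpr G ((\<lambda>s. (s, ts, t)) ` {0..<m}) (rprev q)" "rec_vars (rprev q) = []"
  "rpr_fv (rprev q) \<subseteq> insert t (set ts)"
  by (auto simp: rprev_def)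

lemma rstep_wf:
  "wf_rpr G ((\<lambda>s. (s, ts, t)) ` {0..<m}) (rstep s)" "rec_vars (rstep s) = []"
  "rpr_fv (rstep s) \<subseteq> insert t (set ts)"
  by (auto simp: rstep_def set_transitions rletter_wf(1,2) rprev_wf(1,2)
      dest!: subsetD[OF rletter_wf(3)] subsetD[OF rprev_wf(3)])

lemma rpr_formula_wf: "fo_rpr_formula rpr_formula"
proof -
  \<comment> \<open>The union of the parameter sets over all states equals \<open>set ts\<close>
    only if there is at least one state.\<close>
  have "m > 0" using st_less by (metis gr_zeroI not_less_zero)
  moreover have concat_Nil: "concat (map (\<lambda>s. []) xs) = []" for xs :: "nat list" by simp
  ultimately show ?thesis
    using rstep_wf distinct_ts fresh(1)
    by (auto simp: fo_rpr_formula_def rpr_formula_def image_image comp_def image_iff concat_Nil)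
qed

lemma rpr_formula_fv: "rpr_fv rpr_formula \<subseteq> set ts"
  by (auto simp: rpr_formula_def)


subsection \<open>Monadic second-order logic\<close>

text \<open>Equality is not among the atoms here, so it is expressed by incomparability in the
  linear order.\<close>

definition strack :: "track \<Rightarrow> mso" where
  "strack \<tau> = (case \<tau> of Inl A \<Rightarrow> SPred A t
     | Inr x \<Rightarrow> SConj (SNeg (SLess t x)) (SNeg (SLess x t)))"

definition sletter :: "track set \<Rightarrow> mso" where
  "sletter a = sconj (map (\<lambda>\<tau>. if \<tau> \<in> a then strack \<tau> else SNeg (strack \<tau>)) tracks)"

text \<open>The predecessor is defined by the order as the point below \<open>t\<close> with nothing
  between. At time 0 there is no such \<open>y\<close>, so only the initial-state disjunct can
  hold.\<close>

definition sprev :: "nat \<Rightarrow> mso" where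
  "sprev q =
     (let \<phi> = SEx y (SConj (SConj (SLess y t) (SNeg (SEx z (SConj (SLess y z) (SLess z t)))))
        (SMem q y))
      in if q = st [] then sdisj [SNeg (SEx y (SLess y t)), \<phi>] else \<phi>)"

definition sstep :: "nat \<Rightarrow> mso" where
  "sstep s = sdisj (map (\<lambda>(q, a). SConj (sletter a) (sprev q)) (transitions s))"

text \<open>Set variable \<open>s\<close> collects the points after whose letter the automaton is in
  state \<open>s\<close>. The first conjunct makes the sets a run, the second demands acceptance at
  the last point.\<close>

definition mso_matrix :: mso where
  "mso_matrix = SConj
     (SNeg (SEx t (SNeg (sconj (map (\<lambda>s. siff (SMem s t) (sstep s)) [0..<m])))))
     (SEx t (SConj (SNeg (SEx y (SLess t y)))
       (sdisj (map (\<lambda>s. SMem s t) (filter (\<lambda>s. s \<in> F) [0..<m])))))"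

definition mso_formula :: mso where
  "mso_formula = sex_sets m mso_matrix"

lemma strack_sat:
  "\<tau> \<in> set tracks \<Longrightarrow> mso_sat D I (e(t := n)) \<sigma> (strack \<tau>) \<longleftrightarrow> \<tau> \<in> letter I e n"
  using fresh(1) by (auto simp: strack_def tracks_def split: if_splits)

lemma sletter_sat:
  assumes "a \<subseteq> set tracks"
  shows "mso_sat D I (e(t := n)) \<sigma> (sletter a) \<longleftrightarrow> letter I e n = a"
proof -
  have "mso_sat D I (e(t := n)) \<sigma> (if \<tau> \<in> a then strack \<tau> else SNeg (strack \<tau>)) \<longleftrightarrow>
      (\<tau> \<in> a \<longleftrightarrow> \<tau> \<in> letter I e n)" if "\<tau> \<in> set tracks" for \<tau>
    using strack_sat[OF that] by simp
  then show ?thesis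
    unfolding letter_eqI[OF assms, symmetric] sletter_def sconj set_map ball_simps(9) by blast
qed

lemma sprev_sat:
  assumes "k \<le> N"
    and \<sigma>: "\<And>i. i < k \<Longrightarrow> int i \<in> \<sigma> q \<longleftrightarrow> prefix_state I e (Suc i) = q"
  shows "mso_sat {0..int N} I (e(t := int k)) \<sigma> (sprev q) \<longleftrightarrow> prefix_state I e k = q"
proof (cases k)
  case 0
  have "\<not> n < 0" if "n \<in> {0..int N}" for n using that by simp
  then show ?thesis using fresh by (auto simp: sprev_def 0 Let_def)
next
  case (Suc j)
  have pred: "n < int k \<and> (\<forall>i\<in>{0..int N}. n < i \<longrightarrow> \<not> i < int k) \<longleftrightarrow> n = int j"
    if "n \<in> {0..int N}" for n
  proof
    assume *: "n < int k \<and> (\<forall>i\<in>{0..int N}. n < i \<longrightarrow> \<not> i < int k)"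
    show "n = int j"
    proof (rule ccontr)
      assume "n \<noteq> int j"
      with * Suc have "n < int j" by auto
      moreover have "int j \<in> {0..int N}" using Suc assms(1) by auto
      ultimately show False using * Suc by auto
    qed
  qed (auto simp: Suc)
  have j: "int j \<in> {0..int N}" "int j < int k" using Suc assms(1) by auto
  then have first: "\<exists>n\<in>{0..int N}. n < int k" by blast
  have "mso_sat {0..int N} I (e(t := int k)) \<sigma> (sprev q) \<longleftrightarrow>
      (\<exists>n\<in>{0..int N}. (n < int k \<and> (\<forall>i\<in>{0..int N}. n < i \<longrightarrow> \<not> i < int k)) \<and> n \<in> \<sigma> q)"
    using fresh first by (auto simp: sprev_def Let_def)
  also have "\<dots> \<longleftrightarrow> int j \<in> \<sigma> q" using pred j(1) by blast
  finally show ?thesis using \<sigma>[of j] Suc by simp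
qed

lemma sstep_sat:
  assumes "k \<le> N"
    and "\<And>q i. q < m \<Longrightarrow> i < k \<Longrightarrow> int i \<in> \<sigma> q \<longleftrightarrow> prefix_state I e (Suc i) = q"
  shows "mso_sat {0..int N} I (e(t := int k)) \<sigma> (sstep s) \<longleftrightarrow> prefix_state I e (Suc k) = s"
proof -
  have prev: "mso_sat {0..int N} I (e(t := int k)) \<sigma> (sprev q) \<longleftrightarrow> prefix_state I e k = q"
    if "q < m" for q
    by (rule sprev_sat) (use assms that in auto)
  have "mso_sat {0..int N} I (e(t := int k)) \<sigma> (sstep s) \<longleftrightarrow>
      (\<exists>(q, a)\<in>set (transitions s). letter I e (int k) = a \<and> prefix_state I e k = q)"
    unfolding sstep_def sdisj set_map bex_simps(7)
    by (intro bex_cong refl) (auto simp: sletter_sat set_transitions prev)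
  then show ?thesis by (simp only: ex_transition)
qed

text \<open>The automaton is deterministic, so the local conditions have exactly one solution on the
  domain, namely the actual run; this follows by induction on time.\<close>

lemma mso_matrix_sat:
  "mso_sat {0..int N} I e \<sigma> mso_matrix \<longleftrightarrow>
     (\<forall>s<m. \<forall>k\<le>N. int k \<in> \<sigma> s \<longleftrightarrow> prefix_state I e (Suc k) = s) \<and>
     prefix_state I e (Suc N) \<in> F"
proof -
  have all_D: "(\<forall>n\<in>{0..int N}. R n) \<longleftrightarrow> (\<forall>k\<le>N. R (int k))" for R
  proof
    assume *: "\<forall>k\<le>N. R (int k)"
    show "\<forall>n\<in>{0..int N}. R n"
    proof
      fix n assume "n \<in> {0..int N}"
      then have "nat n \<le> N" "int (nat n) = n" by auto
      with * show "R n" by metis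
    qed
  qed auto
  have last: "(\<forall>k\<in>{0..int N}. \<not> n < k) \<longleftrightarrow> n = int N" if "n \<in> {0..int N}" for n
  proof
    assume "\<forall>k\<in>{0..int N}. \<not> n < k"
    then have "\<not> n < int N" by simp
    with that show "n = int N" by simp
  qed simp
  have "mso_sat {0..int N} I e \<sigma> mso_matrix \<longleftrightarrow>
      (\<forall>n\<in>{0..int N}. \<forall>s<m. n \<in> \<sigma> s \<longleftrightarrow> mso_sat {0..int N} I (e(t := n)) \<sigma> (sstep s)) \<and>
      (\<exists>n\<in>{0..int N}. (\<forall>k\<in>{0..int N}. \<not> n < k) \<and> (\<exists>s<m. s \<in> F \<and> n \<in> \<sigma> s))"
    using fresh(4) by (auto simp: mso_matrix_def)
  also have "\<dots> \<longleftrightarrow>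
      (\<forall>k\<le>N. \<forall>s<m. int k \<in> \<sigma> s \<longleftrightarrow> mso_sat {0..int N} I (e(t := int k)) \<sigma> (sstep s)) \<and>
      (\<exists>s<m. s \<in> F \<and> int N \<in> \<sigma> s)"
    unfolding all_D[of "\<lambda>n. \<forall>s<m. n \<in> \<sigma> s \<longleftrightarrow> mso_sat {0..int N} I (e(t := n)) \<sigma> (sstep s)"]
    using last by auto
  also have "(\<forall>k\<le>N. \<forall>s<m. int k \<in> \<sigma> s \<longleftrightarrow> mso_sat {0..int N} I (e(t := int k)) \<sigma> (sstep s)) \<longleftrightarrow>
      (\<forall>s<m. \<forall>k\<le>N. int k \<in> \<sigma> s \<longleftrightarrow> prefix_state I e (Suc k) = s)" (is "?L \<longleftrightarrow> ?R")
  proof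
    assume L: ?L
    have "int k \<in> \<sigma> s \<longleftrightarrow> prefix_state I e (Suc k) = s" if "k \<le> N" "s < m" for k s
      using that
    \<comment> \<open>\<open>sstep_sat\<close> asks for correctness at all earlier times, hence
      course-of-values induction.\<close>
    proof (induction k arbitrary: s rule: less_induct)
      case (less k)
      then have "mso_sat {0..int N} I (e(t := int k)) \<sigma> (sstep s) \<longleftrightarrow> prefix_state I e (Suc k) = s"
        by (intro sstep_sat) auto
      with L less.prems show ?case by blast
    qed
    then show ?R by blast
  next
    assume R: ?R
    show ?L
    proof (intro allI impI)
      fix k s assume k: "k \<le> N" "s < m"
      with R have "mso_sat {0..int N} I (e(t := int k)) \<sigma> (sstep s) \<longleftrightarrow>
          prefix_state I e (Suc k) = s"
        by (intro sstep_sat) auto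
      with R k show "int k \<in> \<sigma> s \<longleftrightarrow> mso_sat {0..int N} I (e(t := int k)) \<sigma> (sstep s)" by blast
    qed
  qed
  finally show ?thesis using st_less by blast
qed

lemma mso_formula_sat:
  "mso_sat {0..int N} I e \<sigma> mso_formula \<longleftrightarrow> prefix_state I e (Suc N) \<in> F"
proof -
  \<comment> \<open>The actual run is the witness for the guessed sets.\<close>
  let ?\<tau> = "\<lambda>s. {n \<in> {0..int N}. prefix_state I e (Suc (nat n)) = s}"
  have "\<exists>\<tau>. (\<forall>s<m. \<tau> s \<subseteq> {0..int N}) \<and>
      (\<forall>s<m. \<forall>k\<le>N. int k \<in> \<tau> s \<longleftrightarrow> prefix_state I e (Suc k) = s)"
    by (rule exI[of _ ?\<tau>]) auto
  then show ?thesis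
    by (auto simp: mso_formula_def mso_sat_sex_sets mso_matrix_sat)
qed

lemma sletter_fv: "mso_fv (sletter a) \<subseteq> insert t (set ts)" "mso_setfv (sletter a) = {}"
  by (auto simp: sletter_def strack_def tracks_def split: sum.splits)

lemma sprev_fv: "mso_fv (sprev q) \<subseteq> {t}" "mso_setfv (sprev q) = {q}"
  by (auto simp: sprev_def Let_def)

lemma sstep_fv: "mso_fv (sstep s) \<subseteq> insert t (set ts)" "mso_setfv (sstep s) \<subseteq> {..<m}"
  by (auto simp: sstep_def set_transitions sletter_fv(2) sprev_fv(2)
      dest!: subsetD[OF sletter_fv(1)] subsetD[OF sprev_fv(1)])

lemma mso_formula_fv: "mso_fv mso_formula \<subseteq> set ts" "mso_setfv mso_formula = {}"
  using sstep_fv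
  by (auto simp: mso_formula_def mso_matrix_def mso_fv_sex_sets mso_setfv_sex_sets)

end

section \<open>Both rewritings from one automaton\<close>

theorem theorem27:
  fixes \<O> :: "clause set" and \<psi> :: mfo and ts :: "var list"
  assumes "is_omq (\<O>, \<psi>, ts)"
  shows "fo_rpr_rewritable (\<O>, \<psi>, ts) \<and> mso_rewritable (\<O>, \<psi>, ts)"
proof (rule certain_answer_automaton[OF assms])
  fix As :: "acon list" and st :: "track set list \<Rightarrow> nat" and \<delta> m F
  assume st: "\<And>w. st w < m" "\<And>w a. st (w @ [a]) = \<delta> (st w) a"
    and certain: "\<And>\<A> ls N. data_instance \<A> \<Longrightarrow> length ls = length ts \<Longrightarrow> set ls \<subseteq> tem \<A> \<Longrightarrow>
        tem \<A> = {0..int N} \<Longrightarrow>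
        certain_answer (\<O>, \<psi>, ts) \<A> ls \<longleftrightarrow>
        st (data_word (set As) (set ts) (data_interp \<A>) (assign ts ls) (Suc N)) \<in> F"
  have fresh: "\<exists>x. x \<notin> V" if "finite V" for V :: "var set"
    using that ex_new_if_finite infinite_UNIV_nat by blast
  obtain t where t: "t \<notin> set ts" using fresh[of "set ts"] by blast
  obtain y where y: "y \<notin> insert t (set ts)" using fresh[of "insert t (set ts)"] by blast
  obtain z where z: "z \<notin> insert y (insert t (set ts))"
    using fresh[of "insert y (insert t (set ts))"] by blast
  interpret word_automaton As ts st \<delta> m F t y z
    by unfold_locales (use assms st t y z in auto)
  have rpr: "certain_answer (\<O>, \<psi>, ts) \<A> ls \<longleftrightarrow>
        rpr_sat (tem \<A>) (data_interp \<A>) rpr_formula (assign ts ls) (\<lambda>_ _ _. False)"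
    and mso: "certain_answer (\<O>, \<psi>, ts) \<A> ls \<longleftrightarrow>
        mso_sat (tem \<A>) (data_interp \<A>) (assign ts ls) (\<lambda>_. {}) mso_formula"
    if \<A>: "data_instance \<A>" "length ls = length ts" "set ls \<subseteq> tem \<A>" for \<A> ls
  proof -
    \<comment> \<open>Data instances start at 0, so the domain is an initial segment, as the
      recursion on time requires.\<close>
    obtain N where N: "tem \<A> = {0..int N}" using tem_data_instance[OF \<A>(1)] .
    show "certain_answer (\<O>, \<psi>, ts) \<A> ls \<longleftrightarrow>
        rpr_sat (tem \<A>) (data_interp \<A>) rpr_formula (assign ts ls) (\<lambda>_ _ _. False)"
      "certain_answer (\<O>, \<psi>, ts) \<A> ls \<longleftrightarrow>
        mso_sat (tem \<A>) (data_interp \<A>) (assign ts ls) (\<lambda>_. {}) mso_formula"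
      unfolding certain[OF \<A> N] unfolding N rpr_formula_sat mso_formula_sat by (rule refl)+
  qed
  show "fo_rpr_rewritable (\<O>, \<psi>, ts) \<and> mso_rewritable (\<O>, \<psi>, ts)"
    unfolding fo_rpr_rewritable_def mso_rewritable_def is_rewriting_def answer_vars.simps
    using rpr mso rpr_formula_wf rpr_formula_fv mso_formula_fv
    by (intro conjI exI[of _ rpr_formula] exI[of _ mso_formula] allI impI)
qed

end
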